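(* Consider a $2\times2$ traffic game and the associated scalar function $\psi:\mathbb{R}\to\mathbb{R}$, $\psi(w)=\beta_1\varphi(\beta_2\varphi(w))$. The function $\psi$ has either one, two or three fixed points, and exactly one of the following mutually exclusive situations occurs. (a) $\psi$ has a unique fixed point $\bar w$, with $\psi'(\bar w)\le 1$. The corresponding $\bar x$ is the unique rest point of the mean field dynamics, and it is stable if and only if $\psi'(\bar w)<1$. (b) $\psi$ has exactly two fixed points $w_-<w_+$, with either $\psi'(w_-)<1=\psi'(w_+)$ or $\psi'(w_+)<1=\psi'(w_-)$. The corresponding points $x_-$ and $x_+$ are the only rest points of the mean field dynamics. One of them is stable and the other is unstable. (c) $\psi$ has exactly three fixed points $w_-<\bar w<w_+$, with $\psi'(w_-)<1$, $\psi'(w_+)<1$ and $\psi'(\bar w)>1$. The corresponding points $x_-$, $x_+$ and $\bar x$ are the only rest points of the mean field dynamics, with $x_+$ and $x_-$ stable and $\bar x$ unstable.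
   Context: $2\times2$ traffic game: players $i\in\{1,2\}$, routes $r\in\{a,b\}$, real travel times $C_1^r\le C_2^r$ for each route $r$, and parameters $\beta_1,\beta_2>0$. The state is $x=(x^{1a},x^{1b},x^{2a},x^{2b})\in\mathbb{R}^4$, with $x^i=(x^{ia},x^{ib})$. Logit probabilities: $\pi^{ir}(x^i)=\dfrac{e^{-\beta_i x^{ir}}}{e^{-\beta_i x^{ia}}+e^{-\beta_i x^{ib}}}$. Put $\delta^r=C_2^r-C_1^r\ge 0$ and $\delta=\delta^a+\delta^b$. With $j\ne i$ the other player, $C^{ir}(x^{j})=C_1^r+\delta^r\,\pi^{jr}(x^j)$. Mean field dynamics: $\dot x^{ir}=G^{ir}(x):=\pi^{ir}(x^i)\,\bigl(C^{ir}(x^{j})-x^{ir}\bigr)$ for $i\in\{1,2\}$, $r\in\{a,b\}$, $j\neq i$. A rest point is an $x$ with $x^{ir}=C^{ir}(x^j)$ for all $i,r$. A rest point $x$ is called stable if all eigenvalues of the Jacobian matrix of $G$ at $x$ have strictly negative real part, and unstable if it is not stable in this sense. Let $\kappa=C_1^a-C_2^b$, $\rho(w)=1/(1+e^{w})$, $\varphi(w)=\kappa+\delta\rho(w)$. The rest point $x$ corresponding to a fixed point $w$ of $\psi$ is obtained by setting $w^1=w$, $w^2=\beta_2\varphi(w)$, $p_i=\rho(w^i)$, and $x^{1a}=C_1^a+\delta^a p_2$, $x^{1b}=C_2^b-\delta^b p_2$, $x^{2a}=C_1^a+\delta^a p_1$, $x^{2b}=C_2^b-\delta^b p_1$; then $\pi^{ia}(x^i)=p_i$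 and $w^i=\beta_i(x^{ia}-x^{ib})$. *)

theory Defs
  imports "HOL-Analysis.Analysis"
begin

datatype player = P1 | P2
datatype route = Ra | Rb

instance player :: finite
proof
  have "(UNIV :: player set) \<subseteq> {P1, P2}"
    by (auto intro: player.exhaust)
  then show "finite (UNIV :: player set)"
    by (rule finite_subset) simp
qed

instance route :: finite
proof
  have "(UNIV :: route set) \<subseteq> {Ra, Rb}"
    by (auto intro: route.exhaust)
  then show "finite (UNIV :: route set)"
    by (rule finite_subset) simp
qed

fun other :: "player \<Rightarrow> player" where
  "other P1 = P2"
| "other P2 = P1"

(* Component (i, r) of a state is x^{ir}; the index type has four elements. *)
type_synonym state = "real ^ (player \<times> route)"

(* C1 r and C2 r are the travel times on route r when it is used by one and by two players. *)

definition logit :: "(player \<Rightarrow> real) \<Rightarrow> player \<Rightarrow> route \<Rightarrow> state \<Rightarrow> real" where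
  "logit \<beta> i r x =
     exp (- \<beta> i * x $ (i, r)) / (exp (- \<beta> i * x $ (i, Ra)) + exp (- \<beta> i * x $ (i, Rb)))"

definition delta :: "(route \<Rightarrow> real) \<Rightarrow> (route \<Rightarrow> real) \<Rightarrow> route \<Rightarrow> real" where
  "delta C1 C2 r = C2 r - C1 r"

definition expected_cost ::
  "(route \<Rightarrow> real) \<Rightarrow> (route \<Rightarrow> real) \<Rightarrow> (player \<Rightarrow> real) \<Rightarrow> player \<Rightarrow> route \<Rightarrow> state \<Rightarrow> real" where
  "expected_cost C1 C2 \<beta> i r x = C1 r + delta C1 C2 r * logit \<beta> (other i) r x"

definition mean_field ::
  "(route \<Rightarrow> real) \<Rightarrow> (route \<Rightarrow> real) \<Rightarrow> (player \<Rightarrow> real) \<Rightarrow> state \<Rightarrow> state" where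
  "mean_field C1 C2 \<beta> x =
     (\<chi> k. case k of (i, r) \<Rightarrow> logit \<beta> i r x * (expected_cost C1 C2 \<beta> i r x - x $ (i, r)))"

definition rest_point ::
  "(route \<Rightarrow> real) \<Rightarrow> (route \<Rightarrow> real) \<Rightarrow> (player \<Rightarrow> real) \<Rightarrow> state \<Rightarrow> bool" where
  "rest_point C1 C2 \<beta> x \<longleftrightarrow> (\<forall>i r. x $ (i, r) = expected_cost C1 C2 \<beta> i r x)"

(* Eigenvalues of a real matrix are taken over the complex numbers. *)
definition is_eigenvalue :: "real ^ 'n ^ 'n \<Rightarrow> complex \<Rightarrow> bool" where
  "is_eigenvalue M z \<longleftrightarrow> (\<exists>v. v \<noteq> 0 \<and> map_matrix complex_of_real M *v v = z *s v)"

definition stable_rest_point ::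
  "(route \<Rightarrow> real) \<Rightarrow> (route \<Rightarrow> real) \<Rightarrow> (player \<Rightarrow> real) \<Rightarrow> state \<Rightarrow> bool" where
  "stable_rest_point C1 C2 \<beta> x \<longleftrightarrow> rest_point C1 C2 \<beta> x \<and>
     (\<forall>z. is_eigenvalue (jacobian (mean_field C1 C2 \<beta>) (at x)) z \<longrightarrow> Re z < 0)"

definition unstable_rest_point ::
  "(route \<Rightarrow> real) \<Rightarrow> (route \<Rightarrow> real) \<Rightarrow> (player \<Rightarrow> real) \<Rightarrow> state \<Rightarrow> bool" where
  "unstable_rest_point C1 C2 \<beta> x \<longleftrightarrow> rest_point C1 C2 \<beta> x \<and> \<not> stable_rest_point C1 C2 \<beta> x"

definition kappa :: "(route \<Rightarrow> real) \<Rightarrow> (route \<Rightarrow> real) \<Rightarrow> real" where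
  "kappa C1 C2 = C1 Ra - C2 Rb"

definition rho :: "real \<Rightarrow> real" where
  "rho w = 1 / (1 + exp w)"

definition phi :: "(route \<Rightarrow> real) \<Rightarrow> (route \<Rightarrow> real) \<Rightarrow> real \<Rightarrow> real" where
  "phi C1 C2 w = kappa C1 C2 + (delta C1 C2 Ra + delta C1 C2 Rb) * rho w"

definition psi ::
  "(route \<Rightarrow> real) \<Rightarrow> (route \<Rightarrow> real) \<Rightarrow> (player \<Rightarrow> real) \<Rightarrow> real \<Rightarrow> real" where
  "psi C1 C2 \<beta> w = \<beta> P1 * phi C1 C2 (\<beta> P2 * phi C1 C2 w)"

definition corresponding_point ::
  "(route \<Rightarrow> real) \<Rightarrow> (route \<Rightarrow> real) \<Rightarrow> (player \<Rightarrow> real) \<Rightarrow> real \<Rightarrow> state" where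
  "corresponding_point C1 C2 \<beta> w =
     (let p1 = rho w; p2 = rho (\<beta> P2 * phi C1 C2 w)
      in \<chi> k. case k of
           (P1, Ra) \<Rightarrow> C1 Ra + delta C1 C2 Ra * p2
         | (P1, Rb) \<Rightarrow> C2 Rb - delta C1 C2 Rb * p2
         | (P2, Ra) \<Rightarrow> C1 Ra + delta C1 C2 Ra * p1
         | (P2, Rb) \<Rightarrow> C2 Rb - delta C1 C2 Rb * p1)"

definition fixed_points :: "(real \<Rightarrow> real) \<Rightarrow> real set" where
  "fixed_points f = {w. f w = w}"

definition one_fixed_point :: "(real \<Rightarrow> real) \<Rightarrow> real \<Rightarrow> bool" where
  "one_fixed_point f w \<longleftrightarrow> fixed_points f = {w} \<and> deriv f w \<le> 1"

definition two_fixed_points :: "(real \<Rightarrow> real) \<Rightarrow> real \<Rightarrow> real \<Rightarrow> bool" where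
  "two_fixed_points f wm wp \<longleftrightarrow> wm < wp \<and> fixed_points f = {wm, wp} \<and>
     (deriv f wm < 1 \<and> deriv f wp = 1 \<or> deriv f wp < 1 \<and> deriv f wm = 1)"

definition three_fixed_points :: "(real \<Rightarrow> real) \<Rightarrow> real \<Rightarrow> real \<Rightarrow> real \<Rightarrow> bool" where
  "three_fixed_points f wm wb wp \<longleftrightarrow> wm < wb \<and> wb < wp \<and> fixed_points f = {wm, wb, wp} \<and>
     deriv f wm < 1 \<and> deriv f wp < 1 \<and> deriv f wb > 1"

end

theory Submission
  imports Defs
begin

text \<open>
  The theorem combines a shape property of \<open>psi\<close> with an eigenvalue estimate whose
  threshold is exactly \<open>psi' = 1\<close>.

  Shape of \<open>psi\<close>. Up to affine maps, \<open>psi\<close> is a composition of two logistic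
  functions, each of which is a Moebius transformation of \<open>exp\<close>. Such maps have negative
  Schwarzian derivative, and so has their composition; equivalently, \<open>1 / sqrt psi'\<close> is
  strictly convex. Here this is checked by hand: since \<open>rho (1 - rho) = 1 / (2 cosh (w/2))^2\<close>,
  the function \<open>1 / sqrt psi'\<close> is a constant multiple of \<open>cosh (w/2) * cosh (v/2)\<close> with
  \<open>v = beta_2 phi w\<close> when \<open>delta > 0\<close> (for \<open>delta = 0\<close> the function
  \<open>psi\<close> is constant), and in its second derivative the terms of indefinite sign cancel
  (lemma \<open>strict_quasiconvex_cosh_product\<close>). A strictly convex function stays
  strictly below a level between two points where it is at most that level, so \<open>psi' > 1\<close>
  strictly between any two points where \<open>psi' \<ge> 1\<close>. For a bounded function with
  this property, Rolle's theorem excludes four fixed points, and the intermediate value theorem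
  gives the possible patterns of slopes (lemma \<open>fixed_point_trichotomy\<close>).

  Stability. A rest point is determined by the two differences \<open>w^i\<close>, which satisfy
  \<open>w^2 = beta_2 phi (w^1)\<close> and \<open>w^1 = beta_1 phi (w^2)\<close>; so rest points correspond to
  fixed points of \<open>psi\<close>. At a rest point the factor \<open>C^{ir} - x^{ir}\<close> vanishes, hence the
  linearised dynamics of player \<open>i\<close> see the other player only through the difference
  \<open>d_j = v^{ja} - v^{jb}\<close>. Eliminating the components from the eigenvalue equation for \<open>z\<close>
  leaves the scalar condition \<open>s_1 F_1(z) s_2 F_2(z) = 1\<close> (away from the poles), where
  \<open>F_i(z) = p_i delta^a / (z + p_i) + (1 - p_i) delta^b / (z + 1 - p_i)\<close> and
  \<open>s_i = beta_i p_i (1 - p_i)\<close>. On the closed right half plane \<open>|F_i|\<close> is at most its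
  value \<open>delta\<close> at 0, and \<open>s_1 s_2 delta^2\<close> is precisely \<open>psi'\<close> at the fixed point.
  So \<open>psi' < 1\<close> forbids eigenvalues there (lemma \<open>Re_eigenvalue_negative\<close>), while for
  \<open>psi' \<ge> 1\<close> the left side decreases from \<open>psi' \<ge> 1\<close> to 0 along the nonnegative
  real axis and produces a real eigenvalue (lemma \<open>nonneg_eigenvalue_exists\<close>).
\<close>

section \<open>The logistic function\<close>

lemma rho_bounds: "0 < rho w" "rho w < 1"
  by (auto simp: rho_def add_pos_pos)

lemma one_plus_exp_nonzero: "1 + exp w \<noteq> 0" for w :: real
  using exp_gt_zero[of w] by linarith

lemma rho_minus: "rho (- w) = 1 - rho w"
  using one_plus_exp_nonzero[of w] by (simp add: rho_def exp_minus divide_simps)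

lemma DERIV_rho: "(rho has_real_derivative - (rho w * (1 - rho w))) (at w)"
proof -
  have "((\<lambda>w. 1 / (1 + exp w)) has_real_derivative - (rho w * (1 - rho w))) (at w)"
    unfolding rho_def using one_plus_exp_nonzero[of w]
    by (auto intro!: derivative_eq_intros simp: divide_simps)
  then show ?thesis by (simp add: rho_def[abs_def])
qed

lemma rho_times_compl: "rho w * (1 - rho w) = 1 / (4 * (cosh (w / 2))\<^sup>2)"
proof -
  have e: "exp w = (exp (w / 2))\<^sup>2" by (simp flip: exp_double)
  have "4 * (cosh (w / 2))\<^sup>2 = (exp (w / 2) + exp (- (w / 2)))\<^sup>2"
    by (simp add: cosh_def power_mult_distrib power_divide)
  also have "\<dots> = exp w + exp (- w) + 2"
    by (simp add: power2_sum flip: exp_double exp_add)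
  finally have "4 * (cosh (w / 2))\<^sup>2 = exp w + exp (- w) + 2" .
  moreover have "(exp w + exp (- w) + 2) * (rho w * (1 - rho w)) = 1"
    using one_plus_exp_nonzero[of w] unfolding rho_def
    by (simp add: exp_minus divide_simps) (simp add: algebra_simps)
  ultimately show ?thesis by (auto simp: divide_simps mult.commute)
qed

section \<open>Strict convexity of the inverse square root of the derivative\<close>

text \<open>
  In \<open>psi'\<close> the argument of the outer logistic function is a function \<open>v\<close> whose own
  derivative is \<open>- k / cosh (w/2)^2\<close>. Differentiating \<open>U\<close> twice produces two
  mixed terms in \<open>sinh (w/2) * sinh (v/2)\<close>, which cancel; what remains is a positive sum.
  Hence \<open>U\<close> is strictly convex.
\<close>
lemma strict_quasiconvex_cosh_product:
  fixes v :: "real \<Rightarrow> real"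
  assumes v: "\<And>w. (v has_real_derivative - k / (cosh (w / 2))\<^sup>2) (at w)"
    and xyz: "x < y" "y < z"
  defines "U \<equiv> \<lambda>w. cosh (w / 2) * cosh (v w / 2)"
  shows "U y < max (U x) (U z)"
proof -
  define U' where
    "U' = (\<lambda>w. (sinh (w / 2) * cosh (v w / 2) - k * sinh (v w / 2) / cosh (w / 2)) / 2)"
  define U'' where
    "U'' = (\<lambda>w. (cosh (w / 2) * cosh (v w / 2) + k\<^sup>2 * cosh (v w / 2) / cosh (w / 2) ^ 3) / 4)"
  have c: "cosh t \<noteq> 0" for t :: real using cosh_real_pos[of t] by linarith
  have dU: "(U has_real_derivative U' w) (at w)" for w
    unfolding U_def U'_def
    by (auto intro!: derivative_eq_intros v simp: c field_simps power2_eq_square)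
  have dU': "(U' has_real_derivative U'' w) (at w)" for w
    unfolding U'_def U''_def
    by (auto intro!: derivative_eq_intros v simp: c)
      (simp add: c field_simps power2_eq_square power3_eq_cube)
  have "U'' w > 0" for w
    unfolding U''_def by (intro divide_pos_pos add_pos_nonneg mult_pos_pos) auto
  then have mono: "U' s < U' t" if "s < t" for s t
    using DERIV_pos_imp_increasing[OF that] dU' by blast
  obtain s where s: "x < s" "s < y" "U y - U x = (y - x) * U' s"
    using MVT2[OF xyz(1)] dU by blast
  obtain t where t: "y < t" "t < z" "U z - U y = (z - y) * U' t"
    using MVT2[OF xyz(2)] dU by blast
  show ?thesis
  proof (rule ccontr)
    assume "\<not> U y < max (U x) (U z)"
    \<comment> \<open>An interior maximum would make the strictly increasing \<open>U'\<close> go from nonnegative to nonpositive.\<close>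
    then have "(y - x) * U' s \<ge> 0" "(z - y) * U' t \<le> 0" using s t by auto
    then have "U' s \<ge> 0" "U' t \<le> 0" using xyz
      by (auto simp: zero_le_mult_iff mult_le_0_iff)
    moreover have "U' s < U' t" using s t by (intro mono) auto
    ultimately show False by simp
  qed
qed

section \<open>Counting fixed points\<close>

text \<open>
  Think of \<open>g x = f x - x\<close>, which is positive far to the left and negative far to the right.
  Between two zeros of \<open>g\<close> there is a point of slope \<open>f' = 1\<close>, and strictly between two
  such points \<open>f' > 1\<close>. Four zeros would give three points of slope 1, the middle one with
  slope greater than 1. With three zeros, the two points of slope 1 enclose the middle zero, which is
  therefore steep, and an outer zero of slope at least 1 would make the nearer of these two points steep.
  With one or two zeros no slope at a zero exceeds 1, since an upward crossing needs further zeros on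
  both sides; with two zeros, two strict downward crossings would enclose a third zero, and two
  tangencies would force \<open>f' > 1\<close> at the point of slope 1 between them.
\<close>
lemma fixed_point_trichotomy:
  fixes f f' :: "real \<Rightarrow> real"
  assumes der: "\<And>x. (f has_real_derivative f' x) (at x)"
    and bounds: "\<And>x. lo \<le> f x" "\<And>x. f x \<le> hi"
    and steep: "\<And>x y z. x < y \<Longrightarrow> y < z \<Longrightarrow> 1 \<le> f' x \<Longrightarrow> 1 \<le> f' z \<Longrightarrow> 1 < f' y"
  shows "(\<exists>w. one_fixed_point f w) \<or> (\<exists>wm wp. two_fixed_points f wm wp) \<or>
    (\<exists>wm wb wp. three_fixed_points f wm wb wp)"
proof -
  define g where "g = (\<lambda>x. f x - x)"
  define S where "S = fixed_points f"
  have S: "w \<in> S \<longleftrightarrow> g w = 0" for w by (auto simp: S_def g_def fixed_points_def)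
  have dg: "(g has_real_derivative f' x - 1) (at x)" for x
    unfolding g_def by (auto intro!: derivative_eq_intros der)
  have cont: "continuous_on A g" for A
    by (rule DERIV_continuous_on, rule has_field_derivative_at_within, rule dg)
  have df: "deriv f w = f' w" for w using der by (rule DERIV_imp_deriv)
  have low: "g x > 0" if "x < lo" for x using bounds(1)[of x] that by (simp add: g_def)
  have high: "g x < 0" if "x > hi" for x using bounds(2)[of x] that by (simp add: g_def)
  have down: "\<exists>z. a < z \<and> z < b \<and> z \<in> S" if ab: "a < b" "g a > 0" "g b < 0" for a b
  proof -
    obtain z where "a \<le> z" "z \<le> b" "g z = 0"
      using IVT2'[of g b 0 a, OF _ _ _ cont] ab by force
    then show ?thesis using ab by (intro exI[of _ z]) (auto simp: S order_less_le)
  qed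
  have up: "\<exists>z. a < z \<and> z < b \<and> z \<in> S" if ab: "a < b" "g a < 0" "g b > 0" for a b
  proof -
    obtain z where "a \<le> z" "z \<le> b" "g z = 0"
      using IVT'[of g a 0 b, OF _ _ _ cont] ab by force
    then show ?thesis using ab by (intro exI[of _ z]) (auto simp: S order_less_le)
  qed
  have outer: "(\<exists>z\<in>S. z < w) \<and> (\<exists>z\<in>S. w < z)" if w: "w \<in> S" "f' w > 1" for w
  proof
    obtain d where d: "d > 0" "\<And>h. 0 < h \<Longrightarrow> h < d \<Longrightarrow> g (w - h) < g w"
      using DERIV_pos_inc_left[OF dg] w by auto
    have "g (w - d / 2) < 0" using d(2)[of "d / 2"] d(1) w S by auto
    moreover have "g (min lo w - d) > 0" using d(1) by (intro low) auto
    ultimately show "\<exists>z\<in>S. z < w"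
      using down[of "min lo w - d" "w - d / 2"] d(1) by force
    obtain d where d: "d > 0" "\<And>h. 0 < h \<Longrightarrow> h < d \<Longrightarrow> g w < g (w + h)"
      using DERIV_pos_inc_right[OF dg] w by auto
    have "g (w + d / 2) > 0" using d(2)[of "d / 2"] d(1) w S by auto
    moreover have "g (max hi w + d) < 0" using d(1) by (intro high) auto
    ultimately show "\<exists>z\<in>S. w < z"
      using down[of "w + d / 2" "max hi w + d"] d(1) by force
  qed
  have inner: "\<exists>z\<in>S. x < z \<and> z < y"
    if xy: "x < y" "x \<in> S" "y \<in> S" and flat: "f' x < 1" "f' y < 1" for x y
  proof -
    obtain d where d: "d > 0" "\<And>h. 0 < h \<Longrightarrow> h < d \<Longrightarrow> g (x + h) < g x"
      using DERIV_neg_dec_right[OF dg, of x] flat by auto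
    obtain e where e: "e > 0" "\<And>h. 0 < h \<Longrightarrow> h < e \<Longrightarrow> g y < g (y - h)"
      using DERIV_neg_dec_left[OF dg, of y] flat by auto
    \<comment> \<open>A third of the smallest radius keeps the two test points \<open>x + h < y - h\<close> in order.\<close>
    define h where "h = min d (min e (y - x)) / 3"
    then have "0 < 3 * h" "3 * h \<le> d" "3 * h \<le> e" "3 * h \<le> y - x"
      using d(1) e(1) xy(1) by simp_all
    then have h: "0 < h" "h < d" "h < e" "x + h < y - h"
      by linarith+
    have "g (x + h) < 0" "g (y - h) > 0" using d(2)[of h] e(2)[of h] h xy S by auto
    then show ?thesis using up[OF h(4)] h(1) by force
  qed
  have rolle: "\<exists>c. x < c \<and> c < y \<and> f' c = 1" if xy: "x < y" "x \<in> S" "y \<in> S" for x y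
  proof -
    obtain c where "x < c" "c < y" "g y - g x = (y - x) * (f' c - 1)"
      using MVT2[OF xy(1), of g "\<lambda>c. f' c - 1"] dg by blast
    then show ?thesis using xy S by auto
  qed
  have no_four: False if o: "a < b" "b < c" "c < d" and m: "a \<in> S" "b \<in> S" "c \<in> S" "d \<in> S"
    for a b c d
  proof -
    obtain p where p: "a < p" "p < b" "f' p = 1" using rolle[OF o(1) m(1,2)] by blast
    obtain q where q: "b < q" "q < c" "f' q = 1" using rolle[OF o(2) m(2,3)] by blast
    obtain r where r: "c < r" "r < d" "f' r = 1" using rolle[OF o(3) m(3,4)] by blast
    show False using steep[of p q r] p q r by simp
  qed
  have "\<exists>w. w \<in> S" using down[of "min lo hi - 1" "max lo hi + 1"] low high by force
  then obtain w where w: "w \<in> S" by blast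
  consider (one) "S = {w}" | (two) x y where "x < y" "S = {x, y}"
    | (three) x y z where "x < y" "y < z" "x \<in> S" "y \<in> S" "z \<in> S"
  proof (cases "S = {w}")
    case False
    then obtain u where u: "u \<in> S" "u \<noteq> w" using w by blast
    show ?thesis
    proof (cases "S = {u, w}")
      case True
      then show ?thesis using u(2) two[of u w] two[of w u] by (auto simp: insert_commute neq_iff)
    next
      case False
      then obtain t where "t \<in> S" "t \<noteq> u" "t \<noteq> w" using u w by blast
      then show ?thesis using u w three by (metis linorder_neqE)
    qed
  qed (rule one)
  then show ?thesis
  proof cases
    case one
    then have "f' w \<le> 1" using outer[OF w] by fastforce
    then show ?thesis using one by (auto simp: one_fixed_point_def df S_def)
  next
    case (two x y)
    then have m: "x \<in> S" "y \<in> S" by auto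
    have le: "f' x \<le> 1" "f' y \<le> 1" using outer[OF m(1)] outer[OF m(2)] two by force+
    obtain c where "x < c" "c < y" "f' c = 1" using rolle[OF two(1) m] by blast
    then have "\<not> (f' x = 1 \<and> f' y = 1)" using steep[of x c y] by auto
    moreover have "\<not> (f' x < 1 \<and> f' y < 1)" using inner[OF two(1) m] two by force
    ultimately have "two_fixed_points f x y"
      using le two unfolding two_fixed_points_def df S_def by auto
    then show ?thesis by blast
  next
    case (three x y z)
    obtain c where c: "x < c" "c < y" "f' c = 1" using rolle[OF three(1,3,4)] by blast
    obtain d where d: "y < d" "d < z" "f' d = 1" using rolle[OF three(2,4,5)] by blast
    have "f' y > 1" using steep[of c y d] c d by simp
    moreover have "f' x < 1" using steep[of x c d] c d by force
    moreover have "f' z < 1" using steep[of c d z] c d by force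
    moreover have "S = {x, y, z}"
      using no_four three by (auto, metis linorder_neqE)
    ultimately have "three_fixed_points f x y z"
      using three unfolding three_fixed_points_def df S_def by simp
    then show ?thesis by blast
  qed
qed

lemma card_fixed_points:
  "one_fixed_point f w \<Longrightarrow> card (fixed_points f) = 1"
  "two_fixed_points f wm wp \<Longrightarrow> card (fixed_points f) = 2"
  "three_fixed_points f wm wb wp \<Longrightarrow> card (fixed_points f) = 3"
  by (auto simp: one_fixed_point_def two_fixed_points_def three_fixed_points_def)

section \<open>The mean field dynamics near a rest point\<close>

lemma route_cases: "(\<forall>r. P r) \<longleftrightarrow> P Ra \<and> P Rb"
  by (metis route.exhaust)

lemma player_cases: "(\<forall>i. P i) \<longleftrightarrow> P P1 \<and> P P2"
  by (metis player.exhaust)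

lemma UNIV_player_route: "UNIV = {(P1, Ra), (P1, Rb), (P2, Ra), (P2, Rb)}"
  by (auto intro: player.exhaust route.exhaust)

text \<open>
  The two choice probabilities of a player sum to 1, so they respond to the difference of
  that player's two components with opposite signs.
\<close>
fun route_sign :: "route \<Rightarrow> real" where
  "route_sign Ra = 1"
| "route_sign Rb = - 1"

locale traffic_game =
  fixes C1 C2 :: "route \<Rightarrow> real" and \<beta> :: "player \<Rightarrow> real"
  assumes C1_le_C2: "C1 r \<le> C2 r" and \<beta>_pos: "\<beta> i > 0"
begin

abbreviation "\<delta> \<equiv> delta C1 C2"
abbreviation "\<Delta> \<equiv> \<delta> Ra + \<delta> Rb"
abbreviation "\<pi> \<equiv> logit \<beta>"
abbreviation "\<psi> \<equiv> psi C1 C2 \<beta>"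

lemma \<delta>_nonneg: "\<delta> r \<ge> 0"
  using C1_le_C2[of r] by (simp add: delta_def)

text \<open>
  The rate at which the choice probability of player \<open>i\<close> decreases in the difference
  \<open>x^{ia} - x^{ib}\<close>.
\<close>
definition sensitivity :: "player \<Rightarrow> state \<Rightarrow> real" where
  "sensitivity i x = \<beta> i * (\<pi> i Ra x * (1 - \<pi> i Ra x))"

text \<open>
  A factor \<open>sensitivity i x * \<Delta>\<close> is the quasi-static response of the other player's difference
  to that of player \<open>i\<close>; their product is the response to one's own
  difference after a round trip through the opponent. At the point that corresponds to a fixed
  point it is the slope of \<open>\<psi>\<close> there.
\<close>
definition loop_gain :: "state \<Rightarrow> real" where
  "loop_gain x = (sensitivity P1 x * \<Delta>) * (sensitivity P2 x * \<Delta>)"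

lemma logit_eq_rho: "\<pi> i r x = rho (route_sign r * (\<beta> i * (x $ (i, Ra) - x $ (i, Rb))))"
proof -
  have *: "exp s / (exp s + exp t) = rho (t - s)" for s t :: real
    by (simp add: rho_def exp_diff divide_simps add_pos_pos less_imp_neq[THEN not_sym])
  show ?thesis
    using *[of "- \<beta> i * x $ (i, Ra)" "- \<beta> i * x $ (i, Rb)"]
      *[of "- \<beta> i * x $ (i, Rb)" "- \<beta> i * x $ (i, Ra)"]
    by (cases r) (simp_all add: logit_def algebra_simps)
qed

lemma logit_bounds: "0 < \<pi> i r x" "\<pi> i r x < 1"
  by (simp_all add: logit_eq_rho rho_bounds)

lemma logit_Rb: "\<pi> i Rb x = 1 - \<pi> i Ra x"
  by (simp add: logit_eq_rho flip: rho_minus)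

lemma sensitivity_pos: "sensitivity i x > 0"
  using \<beta>_pos logit_bounds[of i Ra x] by (simp add: sensitivity_def)

lemma has_derivative_logit:
  "(\<pi> i r has_derivative
    (\<lambda>h. - route_sign r * sensitivity i x * (h $ (i, Ra) - h $ (i, Rb)))) (at x)"
proof -
  define t where "t = (\<lambda>x :: state. route_sign r * (\<beta> i * (x $ (i, Ra) - x $ (i, Rb))))"
  have t: "(t has_derivative t) (at x)"
    unfolding t_def
    by (intro bounded_linear_imp_has_derivative bounded_linear_const_mult
        bounded_linear_sub bounded_linear_vec_nth)
  have "rho (t x) * (1 - rho (t x)) = \<pi> i Ra x * (1 - \<pi> i Ra x)"
    by (cases r) (auto simp: t_def logit_eq_rho rho_minus)
  then have *: "- (rho (t x) * (1 - rho (t x))) * t h =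
      - route_sign r * sensitivity i x * (h $ (i, Ra) - h $ (i, Rb))" for h
    by (simp add: sensitivity_def t_def mult_ac)
  have "((\<lambda>x. rho (t x)) has_derivative (\<lambda>h. - (rho (t x) * (1 - rho (t x))) * t h)) (at x)"
    by (rule has_derivative_compose[OF t DERIV_rho[unfolded has_field_derivative_def]])
  then show ?thesis
    unfolding * by (simp add: t_def flip: logit_eq_rho)
qed

text \<open>
  At a rest point the cost discrepancy is 0, so differentiating the prefactor \<open>\<pi> i r\<close>
  contributes nothing.
\<close>
lemma has_derivative_mean_field:
  assumes "rest_point C1 C2 \<beta> x"
  shows "(mean_field C1 C2 \<beta> has_derivative
    (\<lambda>h. \<chi> k. case k of (i, r) \<Rightarrow> \<pi> i r x *
      (- \<delta> r * route_sign r * sensitivity (other i) x * (h $ (other i, Ra) - h $ (other i, Rb))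
       - h $ (i, r)))) (at x)"
proof -
  have rest: "C1 r + \<delta> r * \<pi> (other i) r x - x $ (i, r) = 0" for i r
    using assms by (simp add: rest_point_def expected_cost_def)
  have "((\<lambda>x. \<pi> i r x * (C1 r + \<delta> r * \<pi> (other i) r x - x $ (i, r))) has_derivative
    (\<lambda>h. \<pi> i r x *
      (- \<delta> r * route_sign r * sensitivity (other i) x * (h $ (other i, Ra) - h $ (other i, Rb))
       - h $ (i, r)))) (at x)" for i r
    by (rule has_derivative_eq_rhs, (rule derivative_intros has_derivative_logit
          bounded_linear_imp_has_derivative bounded_linear_vec_nth)+)
      (auto simp: rest algebra_simps)
  then show ?thesis
    unfolding mean_field_def expected_cost_def
    by (subst has_derivative_componentwise_within)
      (auto simp: Basis_vec_def inner_axis split: prod.split)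
qed

text \<open>
  Collecting the diagonal terms on the left leaves, on the right, only the difference of the
  opponent's components: the two differences carry all the coupling between the players.
\<close>
lemma is_eigenvalue_jacobian_iff:
  assumes "rest_point C1 C2 \<beta> x"
  shows "is_eigenvalue (jacobian (mean_field C1 C2 \<beta>) (at x)) z \<longleftrightarrow>
    (\<exists>v. v \<noteq> 0 \<and> (\<forall>i r. (z + of_real (\<pi> i r x)) * v $ (i, r) =
      - of_real (\<pi> i r x * \<delta> r * route_sign r * sensitivity (other i) x) *
        (v $ (other i, Ra) - v $ (other i, Rb))))"
proof -
  have J: "jacobian (mean_field C1 C2 \<beta>) (at x) = matrix (\<lambda>h. \<chi> k. case k of (i, r) \<Rightarrow> \<pi> i r x *
      (- \<delta> r * route_sign r * sensitivity (other i) x * (h $ (other i, Ra) - h $ (other i, Rb))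
       - h $ (i, r)))"
    unfolding jacobian_def
    by (rule arg_cong[of _ _ matrix], rule sym, rule frechet_derivative_at,
        rule has_derivative_mean_field[OF assms])
  have "(map_matrix complex_of_real (jacobian (mean_field C1 C2 \<beta>) (at x)) *v v) $ (i, r) =
      - of_real (\<pi> i r x * \<delta> r * route_sign r * sensitivity (other i) x) *
        (v $ (other i, Ra) - v $ (other i, Rb)) - of_real (\<pi> i r x) * v $ (i, r)" for v i r
    unfolding J
    by (cases i; cases r)
      (simp_all add: matrix_vector_mult_def matrix_def UNIV_player_route axis_def algebra_simps)
  moreover have "- a * b - p * u = z * u \<longleftrightarrow> (z + p) * u = - a * b" for a b p u :: complex
    by (auto simp: algebra_simps)
  ultimately show ?thesis
    unfolding is_eigenvalue_def vec_eq_iff[of "_ *v _"] by simp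
qed

section \<open>Eigenvalues\<close>

text \<open>
  For \<open>Re z \<ge> 0\<close> one has \<open>|z + p| \<ge> p\<close>, so the eigenvalue equation bounds
  \<open>|d_1|\<close> by a multiple of \<open>|d_2|\<close> and conversely. Going round once multiplies by
  the loop gain; if that is less than 1 both differences vanish, and with them the
  whole eigenvector.
\<close>
lemma Re_eigenvalue_negative:
  assumes x: "rest_point C1 C2 \<beta> x" and gain: "loop_gain x < 1"
    and z: "is_eigenvalue (jacobian (mean_field C1 C2 \<beta>) (at x)) z"
  shows "Re z < 0"
proof (rule ccontr)
  assume "\<not> Re z < 0"
  obtain v where v: "v \<noteq> 0" and eq: "\<And>i r. (z + of_real (\<pi> i r x)) * v $ (i, r) =
      - of_real (\<pi> i r x * \<delta> r * route_sign r * sensitivity (other i) x) *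
        (v $ (other i, Ra) - v $ (other i, Rb))"
    using z unfolding is_eigenvalue_jacobian_iff[OF x] by blast
  define d where "d i = v $ (i, Ra) - v $ (i, Rb)" for i
  let ?s = "\<lambda>i. sensitivity i x"
  have bound: "cmod (v $ (i, r)) \<le> \<delta> r * ?s (other i) * cmod (d (other i))" for i r
  proof -
    have "\<pi> i r x \<le> Re (z + of_real (\<pi> i r x))" using \<open>\<not> Re z < 0\<close> by simp
    also have "\<dots> \<le> cmod (z + of_real (\<pi> i r x))" by (rule complex_Re_le_cmod)
    finally have "\<pi> i r x * cmod (v $ (i, r)) \<le> cmod ((z + of_real (\<pi> i r x)) * v $ (i, r))"
      by (simp add: norm_mult mult_right_mono)
    also have "\<dots> = \<pi> i r x * (\<delta> r * ?s (other i) * cmod (d (other i)))"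
      unfolding eq d_def using logit_bounds[of i r x] \<delta>_nonneg[of r] sensitivity_pos[of "other i" x]
      by (cases r) (simp_all add: norm_mult abs_mult)
    finally show ?thesis using logit_bounds(1)[of i r x] by simp
  qed
  have d_bound: "cmod (d i) \<le> ?s (other i) * \<Delta> * cmod (d (other i))" for i
    using norm_triangle_ineq4[of "v $ (i, Ra)" "v $ (i, Rb)"] bound[of i Ra] bound[of i Rb]
    by (simp add: d_def algebra_simps)
  have "cmod (d P1) \<le> loop_gain x * cmod (d P1)"
  proof -
    have "cmod (d P1) \<le> ?s P2 * \<Delta> * cmod (d P2)" using d_bound[of P1] by simp
    also have "\<dots> \<le> ?s P2 * \<Delta> * (?s P1 * \<Delta> * cmod (d P1))"
      using d_bound[of P2] sensitivity_pos[of P2 x] \<delta>_nonneg[of Ra] \<delta>_nonneg[of Rb]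
      by (intro mult_left_mono) auto
    finally show ?thesis by (simp add: loop_gain_def mult_ac)
  qed
  then have "(1 - loop_gain x) * cmod (d P1) \<le> 0" by (simp add: algebra_simps)
  then have d1: "d P1 = 0" using gain by (simp add: mult_le_0_iff)
  then have "d P2 = 0" using d_bound[of P2] by simp
  then have "v $ (i, r) = 0" for i r using bound[of i r] d1 by (cases i) auto
  then show False using v by (simp add: vec_eq_iff)
qed

text \<open>
  The scalar characteristic function \<open>H\<close> equals the loop gain \<open>M\<close> at 0. On \<open>l \<ge> 1\<close>
  each of its two factors is at most its value at 0 divided by \<open>l\<close>, so \<open>H M \<le> M / M^2 \<le> 1\<close>
  when \<open>M \<ge> 1\<close>, and \<open>H\<close> takes the value 1 on \<open>{0..M}\<close>. The eigenvector is then written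
  down from the eigenvalue equation, normalised by \<open>d_2 = 1\<close>.
\<close>
lemma nonneg_eigenvalue_exists:
  assumes x: "rest_point C1 C2 \<beta> x" and gain: "loop_gain x \<ge> 1"
  shows "\<exists>l\<ge>0. is_eigenvalue (jacobian (mean_field C1 C2 \<beta>) (at x)) (of_real l)"
proof -
  let ?s = "\<lambda>i. sensitivity i x" and ?M = "loop_gain x"
  define F where
    "F i l = \<pi> i Ra x * \<delta> Ra / (l + \<pi> i Ra x) + \<pi> i Rb x * \<delta> Rb / (l + \<pi> i Rb x)" for i l
  define H where "H l = (?s P1 * F P1 l) * (?s P2 * F P2 l)" for l
  have pos: "l + \<pi> i r x > 0" if "l \<ge> 0" for l i r
    using logit_bounds(1)[of i r x] that by simp
  have ne: "l + \<pi> i r x \<noteq> 0" if "l \<ge> 0" for l i r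
    using pos[OF that, of i r] by linarith
  have H0: "H 0 = ?M"
    using logit_bounds(1)[of P1 Ra x] logit_bounds(1)[of P1 Rb x]
      logit_bounds(1)[of P2 Ra x] logit_bounds(1)[of P2 Rb x]
    by (simp add: H_def F_def loop_gain_def)
  have F_le: "0 \<le> F i l" "F i l \<le> \<Delta> / l" if l: "l \<ge> 1" for i l
  proof -
    have "\<pi> i r x * \<delta> r / (l + \<pi> i r x) \<le> \<delta> r / l" "0 \<le> \<pi> i r x * \<delta> r / (l + \<pi> i r x)" for r
      using logit_bounds[of i r x] \<delta>_nonneg[of r] l
      by (auto intro!: frac_le mult_left_le_one_le)
    from this[of Ra] this[of Rb] show "0 \<le> F i l" "F i l \<le> \<Delta> / l"
      unfolding F_def by (simp_all add: add_divide_distrib)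
  qed
  have "H ?M \<le> (?s P1 * (\<Delta> / ?M)) * (?s P2 * (\<Delta> / ?M))"
    unfolding H_def using F_le[OF gain] sensitivity_pos[of _ x] 
    by (intro mult_mono mult_left_mono mult_nonneg_nonneg order_trans[OF F_le(1) F_le(2)])
      (auto intro: less_imp_le gain)
  also have "\<dots> = ?M / ?M\<^sup>2" by (simp add: loop_gain_def[of x] power2_eq_square)
  also have "\<dots> \<le> 1" using gain by (simp add: power2_eq_square)
  finally have HM: "H ?M \<le> 1" .
  have "continuous_on {0..?M} H"
    unfolding H_def F_def by (intro continuous_intros) (auto simp: ne)
  then obtain l where l: "0 \<le> l" "H l = 1"
    using IVT2'[of H ?M 1 0] H0 HM gain by auto
  define d where "d i = (case i of P1 \<Rightarrow> - ?s P2 * F P1 l | P2 \<Rightarrow> 1)" for i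
  define u where "u i r =
    - route_sign r * (\<pi> i r x * \<delta> r / (l + \<pi> i r x)) * ?s (other i) * d (other i)" for i r
  define v :: "complex ^ (player \<times> route)" where
    "v = (\<chi> k. case k of (i, r) \<Rightarrow> of_real (u i r))"
  \<comment> \<open>For player 1 this is the definition of \<open>d\<close>; for player 2 it is the equation \<open>H l = 1\<close>.\<close>
  have "d i = - ?s (other i) * d (other i) * F i l" for i
    using l(2) by (cases i) (simp_all add: d_def H_def mult_ac)
  then have du: "u i Ra - u i Rb = d i" for i
    by (simp add: u_def F_def algebra_simps)
  have dv: "v $ (i, Ra) - v $ (i, Rb) = of_real (d i)" for i
    by (simp add: v_def flip: du)
  have nz: "v \<noteq> 0" using dv[of P2] by (auto simp: d_def)
  have "(l + \<pi> i r x) * u i r = - (\<pi> i r x * \<delta> r * route_sign r * ?s (other i)) * d (other i)"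
    for i r
    unfolding u_def using ne[OF l(1), of i r] by (simp add: field_simps)
  then have "(of_real l + of_real (\<pi> i r x)) * v $ (i, r) =
      - of_real (\<pi> i r x * \<delta> r * route_sign r * ?s (other i)) *
        (v $ (other i, Ra) - v $ (other i, Rb))" for i r
    unfolding dv by (simp add: v_def flip: of_real_add of_real_mult of_real_minus)
  then show ?thesis
    unfolding is_eigenvalue_jacobian_iff[OF x] using l(1) nz by blast
qed

lemma stable_iff_loop_gain:
  assumes "rest_point C1 C2 \<beta> x"
  shows "stable_rest_point C1 C2 \<beta> x \<longleftrightarrow> loop_gain x < 1"
  using Re_eigenvalue_negative[OF assms] nonneg_eigenvalue_exists[OF assms] assms
  unfolding stable_rest_point_def by (force simp: not_less)

section \<open>Rest points and fixed points\<close>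

lemma logit_corresponding_point:
  assumes "w \<in> fixed_points \<psi>"
  shows "\<pi> P1 Ra (corresponding_point C1 C2 \<beta> w) = rho w"
    and "\<pi> P2 Ra (corresponding_point C1 C2 \<beta> w) = rho (\<beta> P2 * phi C1 C2 w)"
proof -
  let ?x = "corresponding_point C1 C2 \<beta> w"
  define v where "v = \<beta> P2 * phi C1 C2 w"
  have "?x $ (P2, Ra) - ?x $ (P2, Rb) = phi C1 C2 w"
    "?x $ (P1, Ra) - ?x $ (P1, Rb) = phi C1 C2 v"
    unfolding corresponding_point_def Let_def v_def[symmetric]
    by (simp_all add: phi_def kappa_def algebra_simps)
  then show "\<pi> P1 Ra ?x = rho w" "\<pi> P2 Ra ?x = rho (\<beta> P2 * phi C1 C2 w)"
    using assms by (simp_all add: logit_eq_rho fixed_points_def psi_def v_def)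
qed

text \<open>
  At a rest point the difference of the two components of one player is \<open>phi\<close> of the scaled
  difference of the other, which makes the scaled difference of player 1 a fixed point of
  \<open>\<psi>\<close>; it determines all choice probabilities and through them the state.
\<close>
lemma rest_points_eq:
  "{x. rest_point C1 C2 \<beta> x} = corresponding_point C1 C2 \<beta> ` fixed_points \<psi>"
proof (intro equalityI subsetI)
  fix x assume "x \<in> {x. rest_point C1 C2 \<beta> x}"
  then have cost: "x $ (i, r) = C1 r + \<delta> r * \<pi> (other i) r x" for i r
    by (simp add: rest_point_def expected_cost_def)
  define w where "w i = \<beta> i * (x $ (i, Ra) - x $ (i, Rb))" for i
  have p: "\<pi> i Ra x = rho (w i)" "\<pi> i Rb x = 1 - rho (w i)" for i
    by (simp_all add: logit_eq_rho w_def rho_minus)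
  have w: "w i = \<beta> i * phi C1 C2 (w (other i))" for i
    unfolding w_def[of i] cost p phi_def kappa_def delta_def by (simp add: algebra_simps)
  have "w P1 \<in> fixed_points \<psi>"
    using w[of P1] w[of P2] by (simp add: fixed_points_def psi_def)
  moreover have "x = corresponding_point C1 C2 \<beta> (w P1)"
    by (simp add: w[of P2] cost p vec_eq_iff corresponding_point_def player_cases route_cases Let_def
        delta_def algebra_simps)
  ultimately show "x \<in> corresponding_point C1 C2 \<beta> ` fixed_points \<psi>" by blast
next
  fix x assume "x \<in> corresponding_point C1 C2 \<beta> ` fixed_points \<psi>"
  then obtain w where w: "w \<in> fixed_points \<psi>" and x: "x = corresponding_point C1 C2 \<beta> w"
    by blast
  show "x \<in> {x. rest_point C1 C2 \<beta> x}"
    unfolding x using logit_corresponding_point[OF w]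
    by (simp add: rest_point_def expected_cost_def player_cases route_cases
        corresponding_point_def Let_def logit_Rb delta_def algebra_simps)
qed

section \<open>The slope of the scalar map\<close>

lemma DERIV_psi:
  "(\<psi> has_real_derivative
    (\<beta> P1 * (rho (\<beta> P2 * phi C1 C2 w) * (1 - rho (\<beta> P2 * phi C1 C2 w))) * \<Delta>) *
    (\<beta> P2 * (rho w * (1 - rho w)) * \<Delta>)) (at w)"
  unfolding psi_def phi_def
  by (auto intro!: derivative_eq_intros DERIV_rho[THEN DERIV_chain2])

lemma deriv_psi_eq_loop_gain:
  assumes "w \<in> fixed_points \<psi>"
  shows "deriv \<psi> w = loop_gain (corresponding_point C1 C2 \<beta> w)"
  by (simp add: DERIV_imp_deriv[OF DERIV_psi] loop_gain_def sensitivity_def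
      logit_corresponding_point[OF assms] mult_ac)

text \<open>
  Up to the constant \<open>c\<close>, the slope of \<open>\<psi>\<close> is \<open>1 / U^2\<close> with \<open>U\<close> the product of
  hyperbolic cosines above, so upper level sets of the slope are lower level sets of \<open>U\<close>.
\<close>
lemma psi_steep_between:
  assumes "x < y" "y < z" "1 \<le> deriv \<psi> x" "1 \<le> deriv \<psi> z"
  shows "1 < deriv \<psi> y"
proof -
  define v where "v w = \<beta> P2 * phi C1 C2 w" for w
  define U where "U w = cosh (w / 2) * cosh (v w / 2)" for w
  define c where "c = \<beta> P1 * \<beta> P2 * \<Delta>\<^sup>2 / 16"
  have U: "U w > 0" for w by (simp add: U_def)
  have d: "deriv \<psi> w = c / (U w)\<^sup>2" for w
    unfolding DERIV_imp_deriv[OF DERIV_psi] rho_times_compl U_def v_def c_def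
    by (simp add: power_mult_distrib power2_eq_square mult_ac)
  have "(v has_real_derivative - (\<beta> P2 * \<Delta> / 4) / (cosh (w / 2))\<^sup>2) (at w)" for w
    unfolding v_def phi_def
    by (auto intro!: derivative_eq_intros DERIV_rho[THEN DERIV_chain2] simp: rho_times_compl)
  from strict_quasiconvex_cosh_product[OF this assms(1,2)]
  have "U y < U x \<or> U y < U z" by (auto simp: U_def)
  then have "(U y)\<^sup>2 < (U x)\<^sup>2 \<or> (U y)\<^sup>2 < (U z)\<^sup>2"
    using U by (auto intro!: power_strict_mono simp: less_imp_le)
  moreover have "(U x)\<^sup>2 \<le> c" "(U z)\<^sup>2 \<le> c"
    using assms(3,4) U[of x] U[of z] by (simp_all add: d le_divide_eq)
  ultimately show ?thesis using U[of y] by (auto simp: d less_divide_eq)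
qed

lemma psi_bounds:
  "\<beta> P1 * kappa C1 C2 \<le> \<psi> w" "\<psi> w \<le> \<beta> P1 * (kappa C1 C2 + \<Delta>)"
proof -
  have "0 \<le> \<Delta> * rho u" "\<Delta> * rho u \<le> \<Delta>" for u
    using \<delta>_nonneg[of Ra] \<delta>_nonneg[of Rb] rho_bounds[of u]
    by (auto intro: mult_left_le)
  then show "\<beta> P1 * kappa C1 C2 \<le> \<psi> w" "\<psi> w \<le> \<beta> P1 * (kappa C1 C2 + \<Delta>)"
    using \<beta>_pos[of P1] unfolding psi_def phi_def[of C1 C2 "\<beta> P2 * _"] by simp_all
qed

lemma psi_trichotomy:
  "(\<exists>w. one_fixed_point \<psi> w) \<or> (\<exists>wm wp. two_fixed_points \<psi> wm wp) \<or>
   (\<exists>wm wb wp. three_fixed_points \<psi> wm wb wp)"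
proof (rule fixed_point_trichotomy[OF _ psi_bounds psi_steep_between])
  show "(\<psi> has_real_derivative deriv \<psi> w) (at w)" for w
    using DERIV_psi[of w] DERIV_imp_deriv by metis
qed

section \<open>Classification\<close>

lemma rest_point_stability:
  assumes "w \<in> fixed_points \<psi>"
  shows "stable_rest_point C1 C2 \<beta> (corresponding_point C1 C2 \<beta> w) \<longleftrightarrow> deriv \<psi> w < 1"
    and "unstable_rest_point C1 C2 \<beta> (corresponding_point C1 C2 \<beta> w) \<longleftrightarrow> deriv \<psi> w \<ge> 1"
proof -
  have rest: "rest_point C1 C2 \<beta> (corresponding_point C1 C2 \<beta> w)"
    using rest_points_eq assms by blast
  then show "stable_rest_point C1 C2 \<beta> (corresponding_point C1 C2 \<beta> w) \<longleftrightarrow> deriv \<psi> w < 1"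
    and "unstable_rest_point C1 C2 \<beta> (corresponding_point C1 C2 \<beta> w) \<longleftrightarrow> deriv \<psi> w \<ge> 1"
    by (auto simp: unstable_rest_point_def stable_iff_loop_gain deriv_psi_eq_loop_gain[OF assms])
qed

end

theorem theorem2:
  fixes C1 C2 :: "route \<Rightarrow> real" and \<beta> :: "player \<Rightarrow> real"
  assumes "\<And>r. C1 r \<le> C2 r"
    and "\<And>i. \<beta> i > 0"
  shows
    "card (fixed_points (psi C1 C2 \<beta>)) \<in> {1, 2, 3} \<and>
     ((\<exists>w. one_fixed_point (psi C1 C2 \<beta>) w) \<or>
      (\<exists>wm wp. two_fixed_points (psi C1 C2 \<beta>) wm wp) \<or>
      (\<exists>wm wb wp. three_fixed_points (psi C1 C2 \<beta>) wm wb wp)) \<and>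
     \<not> ((\<exists>w. one_fixed_point (psi C1 C2 \<beta>) w) \<and>
        (\<exists>wm wp. two_fixed_points (psi C1 C2 \<beta>) wm wp)) \<and>
     \<not> ((\<exists>w. one_fixed_point (psi C1 C2 \<beta>) w) \<and>
        (\<exists>wm wb wp. three_fixed_points (psi C1 C2 \<beta>) wm wb wp)) \<and>
     \<not> ((\<exists>wm wp. two_fixed_points (psi C1 C2 \<beta>) wm wp) \<and>
        (\<exists>wm wb wp. three_fixed_points (psi C1 C2 \<beta>) wm wb wp)) \<and>
     (\<forall>w. one_fixed_point (psi C1 C2 \<beta>) w \<longrightarrow>
        {x. rest_point C1 C2 \<beta> x} = {corresponding_point C1 C2 \<beta> w} \<and>
        (stable_rest_point C1 C2 \<beta> (corresponding_point C1 C2 \<beta> w) \<longleftrightarrow> deriv (psi C1 C2 \<beta>) w < 1)) \<and>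
     (\<forall>wm wp. two_fixed_points (psi C1 C2 \<beta>) wm wp \<longrightarrow>
        {x. rest_point C1 C2 \<beta> x} =
          {corresponding_point C1 C2 \<beta> wm, corresponding_point C1 C2 \<beta> wp} \<and>
        (stable_rest_point C1 C2 \<beta> (corresponding_point C1 C2 \<beta> wm) \<and>
         unstable_rest_point C1 C2 \<beta> (corresponding_point C1 C2 \<beta> wp) \<or>
         unstable_rest_point C1 C2 \<beta> (corresponding_point C1 C2 \<beta> wm) \<and>
         stable_rest_point C1 C2 \<beta> (corresponding_point C1 C2 \<beta> wp))) \<and>
     (\<forall>wm wb wp. three_fixed_points (psi C1 C2 \<beta>) wm wb wp \<longrightarrow>
        {x. rest_point C1 C2 \<beta> x} =
          {corresponding_point C1 C2 \<beta> wm, corresponding_point C1 C2 \<beta> wp,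
           corresponding_point C1 C2 \<beta> wb} \<and>
        stable_rest_point C1 C2 \<beta> (corresponding_point C1 C2 \<beta> wp) \<and>
        stable_rest_point C1 C2 \<beta> (corresponding_point C1 C2 \<beta> wm) \<and>
        unstable_rest_point C1 C2 \<beta> (corresponding_point C1 C2 \<beta> wb))"
proof -
  interpret traffic_game C1 C2 \<beta> using assms by unfold_locales
  show ?thesis
  proof (intro conjI)
    show "card (fixed_points \<psi>) \<in> {1, 2, 3}"
      using psi_trichotomy card_fixed_points[of \<psi>] by fastforce
  next
    show "\<forall>w. one_fixed_point \<psi> w \<longrightarrow>
        {x. rest_point C1 C2 \<beta> x} = {corresponding_point C1 C2 \<beta> w} \<and>
        (stable_rest_point C1 C2 \<beta> (corresponding_point C1 C2 \<beta> w) \<longleftrightarrow> deriv \<psi> w < 1)"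
      by (auto simp: one_fixed_point_def rest_points_eq rest_point_stability)
  next
    show "\<forall>wm wp. two_fixed_points \<psi> wm wp \<longrightarrow>
        {x. rest_point C1 C2 \<beta> x} =
          {corresponding_point C1 C2 \<beta> wm, corresponding_point C1 C2 \<beta> wp} \<and>
        (stable_rest_point C1 C2 \<beta> (corresponding_point C1 C2 \<beta> wm) \<and>
         unstable_rest_point C1 C2 \<beta> (corresponding_point C1 C2 \<beta> wp) \<or>
         unstable_rest_point C1 C2 \<beta> (corresponding_point C1 C2 \<beta> wm) \<and>
         stable_rest_point C1 C2 \<beta> (corresponding_point C1 C2 \<beta> wp))"
      by (auto simp: two_fixed_points_def rest_points_eq rest_point_stability)
  next
    show "\<forall>wm wb wp. three_fixed_points \<psi> wm wb wp \<longrightarrow>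
        {x. rest_point C1 C2 \<beta> x} =
          {corresponding_point C1 C2 \<beta> wm, corresponding_point C1 C2 \<beta> wp,
           corresponding_point C1 C2 \<beta> wb} \<and>
        stable_rest_point C1 C2 \<beta> (corresponding_point C1 C2 \<beta> wp) \<and>
        stable_rest_point C1 C2 \<beta> (corresponding_point C1 C2 \<beta> wm) \<and>
        unstable_rest_point C1 C2 \<beta> (corresponding_point C1 C2 \<beta> wb)"
      by (auto simp: three_fixed_points_def rest_points_eq rest_point_stability)
  qed (use psi_trichotomy card_fixed_points[of \<psi>] in fastforce)+
qed

end
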